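(* Let $\mathbf{G}(n,\alpha)$ be the Erdős–Rényi graph distribution on $n$ nodes with edge existence probability $\alpha\in[0,1]$. For $\varepsilon>0$ let $p=\frac{1}{e^\varepsilon+1}$ and $\beta=\alpha(1-p)+(1-\alpha)p$. Let $\hat f_\triangle(G,\varepsilon)$ be the output of $\mathsf{LocalRR}_\triangle$ on $G$. If $G\sim\mathbf{G}(n,\alpha)$, then for all $\varepsilon>0$, $$\mathbb{E}\big[(\hat f_\triangle(G,\varepsilon)-f_\triangle(G))^2\big]=O\!\left(\frac{e^{6\varepsilon}}{(e^\varepsilon-1)^6}\,\beta\,n^4\right),$$ where the expectation is over both the draw of $G$ and the randomness of the algorithm, and the implied constant is absolute.
   Context: Graphs are undirected on nodes (users) $v_1,\dots,v_n$ with symmetric adjacency matrix $(a_{i,j})$. $f_\triangle(G)$ is the number of triangles in $G$. In $\mathbf{G}(n,\alpha)$ each of the $\binom n2$ possible edges is present independently with probability $\alpha$. Randomized response: $RR_\varepsilon$ maps a bit $a\in\{0,1\}$ to $1-a$ with probability $p=\frac{1}{e^\varepsilon+1}$ and to $a$ with probability $1-p$. Algorithm $\mathsf{LocalRR}_\triangle$: each user $v_i$ releases $R_i=(RR_\varepsilon(a_{i,1}),\dots,RR_\varepsilon(a_{i,i-1}))$, all applications independent. The data collector forms the noisy graph $G'=(V,E')$ in which, for $i>j$, $(v_i,v_j)\in E'$ if and only if the $j$-th bit of $R_i$ is $1$. It counts $m_3,m_2,m_1,m_0$, the numbers of $3$-element node subsets spanning exactly $3$, $2$, $1$, $0$ edges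 of $G'$, respectively, and outputs $$\hat f_\triangle(G,\varepsilon)=\frac{1}{(e^\varepsilon-1)^3}\left(e^{3\varepsilon}m_3-e^{2\varepsilon}m_2+e^{\varepsilon}m_1-m_0\right).$$ *)

theory Defs
  imports "HOL-Probability.Probability" "HOL-Probability.Product_PMF"
begin

text \<open>
  A graph on the nodes \<open>{1..n}\<close> is represented by its set of edges, each edge being a
  two-element set of nodes. The entry \<open>a\<^sub>i\<^sub>,\<^sub>j\<close> of the adjacency matrix is
  \<open>{i, j} \<in> E\<close>; it is symmetric in \<open>i\<close> and \<open>j\<close> because \<open>{i, j} = {j, i}\<close>.
\<close>

definition possible_edges :: "nat \<Rightarrow> nat set set" where
  "possible_edges n = {e. e \<subseteq> {1..n} \<and> card e = 2}"

definition triangles :: "nat \<Rightarrow> nat set set \<Rightarrow> nat" where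
  "triangles n E =
     card {T. T \<subseteq> {1..n} \<and> card T = 3 \<and> (\<forall>i\<in>T. \<forall>j\<in>T. i \<noteq> j \<longrightarrow> {i, j} \<in> E)}"

definition triples_spanning :: "nat \<Rightarrow> nat set set \<Rightarrow> nat \<Rightarrow> nat" where
  "triples_spanning n E k =
     card {T. T \<subseteq> {1..n} \<and> card T = 3 \<and> card {e \<in> E. e \<subseteq> T} = k}"

definition erdos_renyi :: "nat \<Rightarrow> real \<Rightarrow> nat set set pmf" where
  "erdos_renyi n \<alpha> =
     map_pmf (\<lambda>X. {e \<in> possible_edges n. X e})
       (Pi_pmf (possible_edges n) False (\<lambda>_. bernoulli_pmf \<alpha>))"

definition randomized_response :: "real \<Rightarrow> bool \<Rightarrow> bool pmf" where
  "randomized_response \<epsilon> a =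
     map_pmf (\<lambda>flip. if flip then \<not> a else a) (bernoulli_pmf (1 / (exp \<epsilon> + 1)))"

text \<open>
  A report of user \<open>i\<close> is a function whose value at \<open>j\<close>, for \<open>1 \<le> j < i\<close>, is the
  \<open>j\<close>-th released bit. Outside this range it has the irrelevant default value \<open>False\<close>.
\<close>

definition user_report :: "real \<Rightarrow> nat set set \<Rightarrow> nat \<Rightarrow> (nat \<Rightarrow> bool) pmf" where
  "user_report \<epsilon> E i =
     Pi_pmf {1..<i} False (\<lambda>j. randomized_response \<epsilon> ({i, j} \<in> E))"

definition noisy_graph :: "nat \<Rightarrow> (nat \<Rightarrow> nat \<Rightarrow> bool) \<Rightarrow> nat set set" where
  "noisy_graph n R = {{i, j} | i j. i \<in> {1..n} \<and> j \<in> {1..<i} \<and> R i j}"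

definition triangle_estimate :: "nat \<Rightarrow> real \<Rightarrow> nat set set \<Rightarrow> real" where
  "triangle_estimate n \<epsilon> E' =
     1 / (exp \<epsilon> - 1) ^ 3 *
       (exp (3 * \<epsilon>) * real (triples_spanning n E' 3)
        - exp (2 * \<epsilon>) * real (triples_spanning n E' 2)
        + exp \<epsilon> * real (triples_spanning n E' 1)
        - real (triples_spanning n E' 0))"

definition local_rr_triangle :: "nat \<Rightarrow> real \<Rightarrow> nat set set \<Rightarrow> real pmf" where
  "local_rr_triangle n \<epsilon> E =
     map_pmf (\<lambda>R. triangle_estimate n \<epsilon> (noisy_graph n R))
       (Pi_pmf {1..n} (\<lambda>_. False) (user_report \<epsilon> E))"

end

theory Submission
  imports Defs
begin

text \<open>
  Give each possible edge the weight \<open>e\<^sup>\<epsilon>/(e\<^sup>\<epsilon> - 1)\<close> if it lies in the noisy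
  graph and \<open>-1/(e\<^sup>\<epsilon> - 1)\<close> otherwise. The weight is an unbiased estimate of the true
  adjacency bit, and the output of the algorithm is the sum over all triples of the product of
  the three weights. Hence the error is a sum of centred errors, one for each triple, and the
  errors of two triples without a common edge are uncorrelated. At most \<open>n\<^sup>4\<close> ordered pairs of
  triples share an edge, and each of them contributes at most the second moment of a single
  error, which is \<open>O(e\<^sup>6\<^sup>\<epsilon> \<beta>/(e\<^sup>\<epsilon> - 1)\<^sup>6)\<close> because \<open>e\<^sup>2\<^sup>\<epsilon> \<beta> \<ge> 1/2\<close>.
\<close>

section \<open>Expectations under finitely supported distributions\<close>

lemma expectation_bind_pmf_finite:
  fixes h :: "'b \<Rightarrow> real"
  assumes "finite (set_pmf p)" "\<And>x. x \<in> set_pmf p \<Longrightarrow> finite (set_pmf (f x))"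
  shows "measure_pmf.expectation (p \<bind> f) h =
    measure_pmf.expectation p (\<lambda>x. measure_pmf.expectation (f x) h)"
  using assms
  by (simp add: pmf_expectation_bind[of "set_pmf p"] integral_measure_pmf[of "set_pmf p"])

lemma finite_set_Pi_pmf:
  assumes "finite A" "\<And>x. x \<in> A \<Longrightarrow> finite (set_pmf (p x))"
  shows "finite (set_pmf (Pi_pmf A dflt p))"
  using assms by (auto simp: set_Pi_pmf intro!: finite_PiE_dflt)

text \<open>
  The library's \<open>expectation_prod_Pi_pmf\<close> requires nonnegative factors, but the
  unbiased estimate of an edge takes a negative value.
\<close>

lemma expectation_prod_Pi_pmf_finite:
  fixes f :: "'a \<Rightarrow> 'b \<Rightarrow> real"
  assumes "finite A" "\<And>x. x \<in> A \<Longrightarrow> finite (set_pmf (p x))"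
  shows "measure_pmf.expectation (Pi_pmf A dflt p) (\<lambda>y. \<Prod>x\<in>A. f x (y x)) =
    (\<Prod>x\<in>A. measure_pmf.expectation (p x) (f x))"
  using assms
proof (induction A rule: finite_induct)
  case empty
  then show ?case by simp
next
  case (insert a A)
  have fin: "finite (set_pmf (Pi_pmf A dflt p))"
    using insert by (intro finite_set_Pi_pmf) auto
  have upd: "(\<Prod>x\<in>A. f x ((g(a := y)) x)) = (\<Prod>x\<in>A. f x (g x))" for g y
    using insert.hyps by (intro prod.cong) auto
  have "measure_pmf.expectation (Pi_pmf (insert a A) dflt p) (\<lambda>y. \<Prod>x\<in>insert a A. f x (y x)) =
    measure_pmf.expectation (p a \<bind> (\<lambda>y. map_pmf (\<lambda>g. g(a := y)) (Pi_pmf A dflt p)))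
      (\<lambda>y. \<Prod>x\<in>insert a A. f x (y x))"
    using insert.hyps by (simp add: Pi_pmf_insert' map_pmf_def)
  also have "\<dots> = measure_pmf.expectation (p a) (\<lambda>y. f a y *
      measure_pmf.expectation (Pi_pmf A dflt p) (\<lambda>g. \<Prod>x\<in>A. f x (g x)))"
    using insert.prems insert.hyps fin
    by (subst expectation_bind_pmf_finite) (simp_all add: upd del: fun_upd_apply, simp)
  finally show ?case
    using insert by simp
qed

section \<open>Independence of edges in the joint law of true and noisy graph\<close>

definition edge_outcome :: "nat \<Rightarrow> real \<Rightarrow> real \<Rightarrow> (nat set set \<times> nat set set) pmf" where
  "edge_outcome n \<alpha> \<epsilon> = erdos_renyi n \<alpha> \<bind> (\<lambda>G. map_pmf (\<lambda>R. (G, noisy_graph n R))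
     (Pi_pmf {1..n} (\<lambda>_. False) (user_report \<epsilon> G)))"

text \<open>The pair of true bit and released bit has the same law for every edge, so one functional
  serves all edges. Letting \<open>g\<close> see both bits allows estimates and true bits to be
  mixed in one product.\<close>

definition bit_mean :: "real \<Rightarrow> real \<Rightarrow> (bool \<Rightarrow> bool \<Rightarrow> real) \<Rightarrow> real" where
  "bit_mean \<alpha> \<epsilon> g = measure_pmf.expectation (bernoulli_pmf \<alpha>)
     (\<lambda>x. measure_pmf.expectation (randomized_response \<epsilon> x) (g x))"

lemma finite_possible_edges [simp]: "finite (possible_edges n)"
  by (rule finite_subset[of _ "Pow {1..n}"]) (auto simp: possible_edges_def)

lemma finite_set_randomized_response [simp]: "finite (set_pmf (randomized_response \<epsilon> a))"
  by simp

lemma finite_set_user_reports [simp]: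
  "finite (set_pmf (Pi_pmf {1..n} (\<lambda>_. False) (user_report \<epsilon> G)))"
  by (intro finite_set_Pi_pmf) (auto simp: user_report_def intro!: finite_set_Pi_pmf)

lemma finite_set_erdos_renyi [simp]: "finite (set_pmf (erdos_renyi n \<alpha>))"
  by (auto simp: erdos_renyi_def intro!: finite_imageI finite_set_Pi_pmf)

lemma finite_set_edge_outcome [simp]: "finite (set_pmf (edge_outcome n \<alpha> \<epsilon>))"
  by (auto simp: edge_outcome_def simp del: One_nat_def)

text \<open>An edge is released only by its larger endpoint \<open>i\<close>, as bit
  \<open>j < i\<close>, so these ordered pairs list each edge once. This turns products over edges
  into products over users and their bits.\<close>

lemma bij_betw_possible_edges:
  "bij_betw (\<lambda>(i, j). {i, j}) (SIGMA i:{1..n}. {1..<i}) (possible_edges n)"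
  unfolding bij_betw_def
proof
  show "inj_on (\<lambda>(i, j). {i, j}) (SIGMA i:{1..n}. {1..<i})"
    by (auto simp: inj_on_def doubleton_eq_iff)
  show "(\<lambda>(i, j). {i, j}) ` (SIGMA i:{1..n}. {1..<i}) = possible_edges n"
  proof (intro equalityI subsetI)
    fix e assume "e \<in> possible_edges n"
    then obtain x y where "e = {x, y}" "x \<noteq> y" "x \<in> {1..n}" "y \<in> {1..n}"
      by (auto simp: possible_edges_def card_2_iff)
    then have "e = (\<lambda>(i, j). {i, j}) (max x y, min x y)"
      "(max x y, min x y) \<in> (SIGMA i:{1..n}. {1..<i})"
      by (auto simp: max_def min_def)
    then show "e \<in> (\<lambda>(i, j). {i, j}) ` (SIGMA i:{1..n}. {1..<i})"
      by (rule image_eqI)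
  qed (auto simp: possible_edges_def)
qed

lemma prod_possible_edges:
  fixes h :: "nat set \<Rightarrow> 'a :: comm_monoid_mult"
  shows "(\<Prod>e\<in>possible_edges n. h e) = (\<Prod>i\<in>{1..n}. \<Prod>j\<in>{1..<i}. h {i, j})"
  using prod.reindex_bij_betw[OF bij_betw_possible_edges[of n], of h]
  by (simp add: prod.Sigma case_prod_unfold)

lemma mem_noisy_graph_iff:
  assumes "i \<in> {1..n}" "j \<in> {1..<i}"
  shows "{i, j} \<in> noisy_graph n R \<longleftrightarrow> R i j"
proof
  show "R i j" if "{i, j} \<in> noisy_graph n R"
    using that assms by (auto simp: noisy_graph_def doubleton_eq_iff)
  show "{i, j} \<in> noisy_graph n R" if "R i j"
    unfolding noisy_graph_def
    using that assms by (intro CollectI exI[of _ i] exI[of _ j] conjI refl)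
qed

lemma noisy_graph_subset: "noisy_graph n R \<subseteq> possible_edges n"
  by (auto simp: noisy_graph_def possible_edges_def)

lemma set_edge_outcome:
  assumes "(G, E) \<in> set_pmf (edge_outcome n \<alpha> \<epsilon>)"
  shows "G \<subseteq> possible_edges n" "E \<subseteq> possible_edges n"
  using assms noisy_graph_subset[of n] by (auto simp: edge_outcome_def erdos_renyi_def)

text \<open>Given the graph, the reports are independent, and so are the bits within a report; the
  bits of the random graph are independent too. The product formula is therefore applied three
  times: over users, over the bits of a report, and over the edges of the graph.\<close>

lemma expectation_edge_product:
  fixes g :: "nat set \<Rightarrow> bool \<Rightarrow> bool \<Rightarrow> real"
  shows "measure_pmf.expectation (edge_outcome n \<alpha> \<epsilon>)
      (\<lambda>(G, E). \<Prod>e\<in>possible_edges n. g e (e \<in> G) (e \<in> E)) =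
    (\<Prod>e\<in>possible_edges n. bit_mean \<alpha> \<epsilon> (g e))"
proof -
  have inner: "measure_pmf.expectation (Pi_pmf {1..n} (\<lambda>_. False) (user_report \<epsilon> G))
      (\<lambda>R. \<Prod>e\<in>possible_edges n. g e (e \<in> G) (e \<in> noisy_graph n R)) =
    (\<Prod>e\<in>possible_edges n. measure_pmf.expectation (randomized_response \<epsilon> (e \<in> G)) (g e (e \<in> G)))"
    for G
  proof -
    have "(\<Prod>e\<in>possible_edges n. g e (e \<in> G) (e \<in> noisy_graph n R)) =
      (\<Prod>i\<in>{1..n}. \<Prod>j\<in>{1..<i}. g {i, j} ({i, j} \<in> G) (R i j))" for R
      unfolding prod_possible_edges
      by (intro prod.cong refl) (simp add: mem_noisy_graph_iff)
    then have "measure_pmf.expectation (Pi_pmf {1..n} (\<lambda>_. False) (user_report \<epsilon> G))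
      (\<lambda>R. \<Prod>e\<in>possible_edges n. g e (e \<in> G) (e \<in> noisy_graph n R)) =
      measure_pmf.expectation (Pi_pmf {1..n} (\<lambda>_. False) (user_report \<epsilon> G))
      (\<lambda>R. \<Prod>i\<in>{1..n}. (\<lambda>r. \<Prod>j\<in>{1..<i}. g {i, j} ({i, j} \<in> G) (r j)) (R i))"
      by simp
    also have "\<dots> = (\<Prod>i\<in>{1..n}. measure_pmf.expectation (user_report \<epsilon> G i)
        (\<lambda>r. \<Prod>j\<in>{1..<i}. g {i, j} ({i, j} \<in> G) (r j)))"
      by (rule expectation_prod_Pi_pmf_finite)
        (auto simp: user_report_def intro!: finite_set_Pi_pmf)
    also have "\<dots> = (\<Prod>i\<in>{1..n}. \<Prod>j\<in>{1..<i}.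
        measure_pmf.expectation (randomized_response \<epsilon> ({i, j} \<in> G)) (g {i, j} ({i, j} \<in> G)))"
      unfolding user_report_def
      by (intro prod.cong refl expectation_prod_Pi_pmf_finite) auto
    finally show ?thesis
      by (simp add: prod_possible_edges)
  qed
  have "measure_pmf.expectation (edge_outcome n \<alpha> \<epsilon>)
      (\<lambda>(G, E). \<Prod>e\<in>possible_edges n. g e (e \<in> G) (e \<in> E)) =
    measure_pmf.expectation (erdos_renyi n \<alpha>) (\<lambda>G. \<Prod>e\<in>possible_edges n.
      measure_pmf.expectation (randomized_response \<epsilon> (e \<in> G)) (g e (e \<in> G)))"
    unfolding edge_outcome_def by (subst expectation_bind_pmf_finite) (simp_all add: inner del: One_nat_def)
  also have "\<dots> = measure_pmf.expectation (Pi_pmf (possible_edges n) False (\<lambda>_. bernoulli_pmf \<alpha>))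
     (\<lambda>X. \<Prod>e\<in>possible_edges n. measure_pmf.expectation (randomized_response \<epsilon> (X e)) (g e (X e)))"
    unfolding erdos_renyi_def integral_map_pmf
    by (intro arg_cong[where f = "integral\<^sup>L _"] ext prod.cong) auto
  also have "\<dots> = (\<Prod>e\<in>possible_edges n. bit_mean \<alpha> \<epsilon> (g e))"
    unfolding bit_mean_def
    by (rule expectation_prod_Pi_pmf_finite) simp_all
  finally show ?thesis .
qed

lemma bit_mean_one [simp]: "bit_mean \<alpha> \<epsilon> (\<lambda>_ _. 1) = 1"
  by (simp add: bit_mean_def)

text \<open>In the product over all edges, those outside \<open>S \<union> T\<close> receive the
  constant factor 1, whose mean is 1. Disjointness gives every other edge a factor from exactly one
  of \<open>f\<close> and \<open>g\<close>.\<close>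

lemma expectation_disjoint_edge_products:
  fixes f g :: "bool \<Rightarrow> bool \<Rightarrow> real"
  assumes "S \<subseteq> possible_edges n" "T \<subseteq> possible_edges n" "S \<inter> T = {}"
  shows "measure_pmf.expectation (edge_outcome n \<alpha> \<epsilon>)
      (\<lambda>(G, E). (\<Prod>e\<in>S. f (e \<in> G) (e \<in> E)) * (\<Prod>e\<in>T. g (e \<in> G) (e \<in> E))) =
    bit_mean \<alpha> \<epsilon> f ^ card S * bit_mean \<alpha> \<epsilon> g ^ card T"
proof -
  let ?h = "\<lambda>e. if e \<in> S then f else if e \<in> T then g else (\<lambda>_ _. 1)"
  have split: "(\<Prod>e\<in>possible_edges n. (if e \<in> S then a e else if e \<in> T then b e else 1)) =
    (\<Prod>e\<in>S. a e) * (\<Prod>e\<in>T. b e)" for a b :: "nat set \<Rightarrow> real"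
  proof -
    have "(\<Prod>e\<in>possible_edges n. (if e \<in> S then a e else if e \<in> T then b e else 1)) =
      (\<Prod>e\<in>possible_edges n. (if e \<in> S then a e else 1) * (if e \<in> T then b e else 1))"
      using assms by (intro prod.cong) auto
    also have "\<dots> = (\<Prod>e\<in>possible_edges n \<inter> S. a e) * (\<Prod>e\<in>possible_edges n \<inter> T. b e)"
      by (simp add: prod.distrib prod.inter_restrict)
    finally show ?thesis
      using assms by (simp add: Int_absorb1)
  qed
  have "measure_pmf.expectation (edge_outcome n \<alpha> \<epsilon>)
      (\<lambda>(G, E). \<Prod>e\<in>possible_edges n. ?h e (e \<in> G) (e \<in> E)) =
    (\<Prod>e\<in>possible_edges n. bit_mean \<alpha> \<epsilon> (?h e))"
    by (rule expectation_edge_product)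
  moreover have "(\<Prod>e\<in>possible_edges n. ?h e (e \<in> G) (e \<in> E)) =
     (\<Prod>e\<in>S. f (e \<in> G) (e \<in> E)) * (\<Prod>e\<in>T. g (e \<in> G) (e \<in> E))" for G E
    by (subst split[symmetric], intro prod.cong) auto
  moreover have "(\<Prod>e\<in>possible_edges n. bit_mean \<alpha> \<epsilon> (?h e)) =
     (\<Prod>e\<in>S. bit_mean \<alpha> \<epsilon> f) * (\<Prod>e\<in>T. bit_mean \<alpha> \<epsilon> g)"
    by (subst split[symmetric], intro prod.cong) auto
  ultimately show ?thesis
    by simp
qed

lemma expectation_edge_product_square:
  fixes f :: "bool \<Rightarrow> bool \<Rightarrow> real"
  assumes "S \<subseteq> possible_edges n"
  shows "measure_pmf.expectation (edge_outcome n \<alpha> \<epsilon>)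
      (\<lambda>(G, E). (\<Prod>e\<in>S. f (e \<in> G) (e \<in> E))\<^sup>2) =
    bit_mean \<alpha> \<epsilon> (\<lambda>x y. (f x y)\<^sup>2) ^ card S"
  using expectation_disjoint_edge_products[OF assms, of "{}" \<alpha> \<epsilon> "\<lambda>x y. (f x y)\<^sup>2" "\<lambda>_ _. 1"]
  by (simp add: prod_power_distrib)

section \<open>First and second moments of a single edge weight\<close>

definition edge_estimate :: "real \<Rightarrow> bool \<Rightarrow> bool \<Rightarrow> real" where
  "edge_estimate \<epsilon> x y = (if y then exp \<epsilon> else -1) / (exp \<epsilon> - 1)"

definition edge_truth :: "bool \<Rightarrow> bool \<Rightarrow> real" where
  "edge_truth x y = of_bool x"

lemma bit_mean_eq:
  fixes \<epsilon> :: real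
  assumes "0 \<le> \<alpha>" "\<alpha> \<le> 1"
  defines "p \<equiv> 1 / (exp \<epsilon> + 1)"
  shows "bit_mean \<alpha> \<epsilon> g = \<alpha> * ((1 - p) * g True True + p * g True False) +
    (1 - \<alpha>) * (p * g False True + (1 - p) * g False False)"
proof -
  have "0 \<le> p" "p \<le> 1" by (simp_all add: p_def divide_le_eq add_pos_pos)
  then show ?thesis
    using assms(1,2)
    by (simp add: bit_mean_def randomized_response_def flip: p_def) (simp add: algebra_simps)
qed

lemma bit_mean_edge_truth:
  assumes "0 \<le> \<alpha>" "\<alpha> \<le> 1"
  shows "bit_mean \<alpha> \<epsilon> edge_truth = \<alpha>"
  unfolding bit_mean_eq[OF assms] edge_truth_def by (simp add: algebra_simps)

text \<open>With flip probability \<open>p\<close> and the noisy bit \<open>y\<close> read as 0 or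
  1, the weight is \<open>(y - p) / (1 - 2 * p)\<close>. It inverts the affine map from a true bit
  \<open>x\<close> to the mean \<open>p + (1 - 2 * p) * x\<close> of its released bit.\<close>

lemma bit_mean_edge_estimate:
  assumes "0 \<le> \<alpha>" "\<alpha> \<le> 1" "0 < \<epsilon>"
  shows "bit_mean \<alpha> \<epsilon> (edge_estimate \<epsilon>) = \<alpha>"
proof -
  define q p where "q = exp \<epsilon>" and "p = 1 / (q + 1)"
  have "q > 1" using assms by (simp add: q_def)
  then have "p * (q + 1) = 1" by (simp add: p_def)
  then have p: "p * q = 1 - p" by (simp add: algebra_simps)
  \<comment> \<open>Up to the factor \<open>q - 1\<close>, the two brackets are the conditional
    means for a present and an absent edge; they equal \<open>q - 1\<close> and 0.\<close>
  have "bit_mean \<alpha> \<epsilon> (edge_estimate \<epsilon>) =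
    (\<alpha> * ((1 - p) * q - p) + (1 - \<alpha>) * (p * q - (1 - p))) / (q - 1)"
    unfolding bit_mean_eq[OF assms(1,2)] edge_estimate_def q_def[symmetric] p_def[symmetric]
    by (simp add: divide_inverse algebra_simps)
  also have "(1 - p) * q - p = q - 1" using p by (simp add: algebra_simps)
  finally show ?thesis using p \<open>q > 1\<close> by simp
qed

text \<open>For the cube of the second moment, one factor is bounded by the first claim, which
  supplies \<beta>, and two by the second, so the constant stays 3 instead of 27. The bound on
  \<alpha> serves the contribution of the true triangles.\<close>

lemma edge_mean_square_bounds:
  fixes \<alpha> \<epsilon> :: real
  assumes "0 \<le> \<alpha>" "\<alpha> \<le> 1" "0 < \<epsilon>"
  defines "p \<equiv> 1 / (exp \<epsilon> + 1)"
  defines "\<beta> \<equiv> \<alpha> * (1 - p) + (1 - \<alpha>) * p"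
  shows "bit_mean \<alpha> \<epsilon> (\<lambda>x y. (edge_estimate \<epsilon> x y)\<^sup>2) \<le> 3 * exp \<epsilon> ^ 2 * \<beta> / (exp \<epsilon> - 1) ^ 2"
    and "bit_mean \<alpha> \<epsilon> (\<lambda>x y. (edge_estimate \<epsilon> x y)\<^sup>2) \<le> exp \<epsilon> ^ 2 / (exp \<epsilon> - 1) ^ 2"
    and "0 \<le> bit_mean \<alpha> \<epsilon> (\<lambda>x y. (edge_estimate \<epsilon> x y)\<^sup>2)"
    and "\<alpha> \<le> 2 * \<beta>" and "0 \<le> \<beta>"
proof -
  define q where "q = exp \<epsilon>"
  have q: "q > 1" using assms(3) by (simp add: q_def)
  have p: "0 \<le> p" "p \<le> 1 / 2" "p * (q + 1) = 1"
    unfolding p_def q_def[symmetric] using q by (simp_all add: divide_le_eq)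
  have \<beta>p: "\<beta> = p + \<alpha> * (1 - 2 * p)" by (simp add: \<beta>_def algebra_simps)
  have "p \<le> \<beta>" unfolding \<beta>p using p assms(1,2) by simp
  then show "0 \<le> \<beta>" using p by simp
  have "\<beta> \<le> 1"
    unfolding \<beta>_def using p assms(1,2) by (intro convex_bound_le) auto
  have "\<alpha> * (1 / 2) \<le> \<alpha> * (1 - p)" using p assms(1,2) by (intro mult_left_mono) auto
  moreover have "0 \<le> (1 - \<alpha>) * p" using p assms(1,2) by simp
  ultimately show "\<alpha> \<le> 2 * \<beta>" unfolding \<beta>_def by argo
  \<comment> \<open>\<beta> is the probability that the released bit is 1, and the squared weight
    depends on that bit alone.\<close>
  have mean: "bit_mean \<alpha> \<epsilon> (\<lambda>x y. (edge_estimate \<epsilon> x y)\<^sup>2) = (q\<^sup>2 * \<beta> + (1 - \<beta>)) / (q - 1)\<^sup>2"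
    unfolding bit_mean_eq[of \<alpha> \<epsilon>, OF assms(1,2), folded p_def] edge_estimate_def q_def[symmetric]
    by (simp add: power_divide) (simp add: \<beta>_def divide_inverse algebra_simps)
  show "0 \<le> bit_mean \<alpha> \<epsilon> (\<lambda>x y. (edge_estimate \<epsilon> x y)\<^sup>2)"
    unfolding mean using \<open>0 \<le> \<beta>\<close> \<open>\<beta> \<le> 1\<close> by simp
  have "1 \<le> q\<^sup>2" using q by (simp add: one_le_power)
  have "1 - \<beta> \<le> q\<^sup>2 * (1 - \<beta>)"
    using mult_right_mono[OF \<open>1 \<le> q\<^sup>2\<close>, of "1 - \<beta>"] \<open>\<beta> \<le> 1\<close> by simp
  then have "q\<^sup>2 * \<beta> + (1 - \<beta>) \<le> q\<^sup>2" by (simp add: algebra_simps)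
  then show "bit_mean \<alpha> \<epsilon> (\<lambda>x y. (edge_estimate \<epsilon> x y)\<^sup>2) \<le> exp \<epsilon> ^ 2 / (exp \<epsilon> - 1) ^ 2"
    unfolding mean q_def[symmetric] by (intro divide_right_mono) auto
  \<comment> \<open>With \<open>p * (q + 1) = 1\<close> and \<open>p \<le> \<beta>\<close> this
    gives \<open>1 \<le> \<beta> * (2 * q\<^sup>2)\<close>, which absorbs the summand
    \<open>1 - \<beta>\<close>; hence the constant 3 = 1 + 2.\<close>
  have "q + 1 \<le> 2 * q\<^sup>2"
    using q \<open>1 \<le> q\<^sup>2\<close> self_le_power[of q 2] by simp
  then have "p * (q + 1) \<le> p * (2 * q\<^sup>2)" using p by (intro mult_left_mono) auto
  also have "\<dots> \<le> \<beta> * (2 * q\<^sup>2)" using \<open>p \<le> \<beta>\<close> by (intro mult_right_mono) auto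
  finally have "1 \<le> \<beta> * (2 * q\<^sup>2)" using p by simp
  then have "q\<^sup>2 * \<beta> + (1 - \<beta>) \<le> 3 * q\<^sup>2 * \<beta>" using \<open>0 \<le> \<beta>\<close> by (simp add: algebra_simps)
  then show "bit_mean \<alpha> \<epsilon> (\<lambda>x y. (edge_estimate \<epsilon> x y)\<^sup>2) \<le> 3 * exp \<epsilon> ^ 2 * \<beta> / (exp \<epsilon> - 1) ^ 2"
    unfolding mean q_def[symmetric] by (intro divide_right_mono) auto
qed

section \<open>Decomposition of the error over triples of nodes\<close>

definition triples :: "nat \<Rightarrow> nat set set" where
  "triples n = {T. T \<subseteq> {1..n} \<and> card T = 3}"

definition edges_of :: "nat set \<Rightarrow> nat set set" where
  "edges_of T = {e. e \<subseteq> T \<and> card e = 2}"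

definition triple_error :: "real \<Rightarrow> nat set \<Rightarrow> nat set set \<Rightarrow> nat set set \<Rightarrow> real" where
  "triple_error \<epsilon> T G E = (\<Prod>e\<in>edges_of T. edge_estimate \<epsilon> (e \<in> G) (e \<in> E)) -
     (\<Prod>e\<in>edges_of T. edge_truth (e \<in> G) (e \<in> E))"

lemma finite_triples [simp]: "finite (triples n)"
  by (rule finite_subset[of _ "Pow {1..n}"]) (auto simp: triples_def)

lemma
  assumes "T \<in> triples n"
  shows edges_of_subset: "edges_of T \<subseteq> possible_edges n"
    and finite_edges_of: "finite (edges_of T)"
    and card_edges_of: "card (edges_of T) = 3"
proof -
  show *: "edges_of T \<subseteq> possible_edges n"
    using assms by (auto simp: edges_of_def possible_edges_def triples_def)
  show "finite (edges_of T)"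
    by (rule finite_subset[OF *]) simp
  have "finite T" using assms by (auto simp: triples_def intro: finite_subset)
  from n_subsets[OF this, of 2] show "card (edges_of T) = 3"
    using assms by (simp add: triples_def edges_of_def numeral_eq_Suc)
qed

text \<open>A product of 0/1 bits is the indicator that all three edges are present.\<close>

lemma triangles_eq_sum:
  "real (triangles n G) = (\<Sum>T\<in>triples n. \<Prod>e\<in>edges_of T. edge_truth (e \<in> G) (e \<in> E))"
proof -
  have iff: "(\<forall>i\<in>T. \<forall>j\<in>T. i \<noteq> j \<longrightarrow> {i, j} \<in> G) \<longleftrightarrow> edges_of T \<subseteq> G" for T
  proof
    show "edges_of T \<subseteq> G" if "\<forall>i\<in>T. \<forall>j\<in>T. i \<noteq> j \<longrightarrow> {i, j} \<in> G"
      using that by (auto simp: edges_of_def card_2_iff)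
    show "\<forall>i\<in>T. \<forall>j\<in>T. i \<noteq> j \<longrightarrow> {i, j} \<in> G" if "edges_of T \<subseteq> G"
      using that by (auto simp: edges_of_def subset_iff)
  qed
  have *: "(\<Prod>e\<in>edges_of T. edge_truth (e \<in> G) (e \<in> E)) = of_bool (edges_of T \<subseteq> G)"
    if "T \<in> triples n" for T
    using finite_edges_of[OF that] by (auto simp: edge_truth_def subset_iff intro!: prod.neutral)
  have "triangles n G = card {T \<in> triples n. edges_of T \<subseteq> G}"
    unfolding triangles_def iff by (simp add: triples_def)
  also have "real \<dots> = (\<Sum>T\<in>triples n. of_bool (edges_of T \<subseteq> G))"
    by (simp add: Int_def)
  finally show ?thesis
    by (simp add: *)
qed

text \<open>This explains the coefficients of the estimator: a triple with \<open>k\<close> noisy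
  edges has \<open>k\<close> factors \<open>exp \<epsilon>\<close> and \<open>3 - k\<close> factors
  -1, which is the coefficient of the count of such triples.\<close>

lemma prod_edge_estimate:
  assumes "T \<in> triples n"
  shows "(\<Prod>e\<in>edges_of T. edge_estimate \<epsilon> (e \<in> G) (e \<in> E)) =
    exp \<epsilon> ^ card (E \<inter> edges_of T) * (-1) ^ (3 - card (E \<inter> edges_of T)) / (exp \<epsilon> - 1) ^ 3"
proof -
  note fin = finite_edges_of[OF assms]
  have "(\<Prod>e\<in>edges_of T. edge_estimate \<epsilon> (e \<in> G) (e \<in> E)) =
    (\<Prod>e\<in>edges_of T. if e \<in> E then exp \<epsilon> else -1) / (exp \<epsilon> - 1) ^ 3"
    by (simp add: edge_estimate_def prod_dividef card_edges_of[OF assms])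
  also have "(\<Prod>e\<in>edges_of T. if e \<in> E then exp \<epsilon> else -1) =
     exp \<epsilon> ^ card (edges_of T \<inter> E) * (-1) ^ card (edges_of T - E)"
    using fin by (simp add: prod.If_cases Diff_eq)
  also have "card (edges_of T - E) = 3 - card (E \<inter> edges_of T)"
    using fin card_edges_of[OF assms] by (metis Int_commute card_Diff_subset_Int finite_Int)
  finally show ?thesis
    by (simp add: Int_commute)
qed

lemma triangle_estimate_eq_sum:
  assumes "E \<subseteq> possible_edges n"
  shows "triangle_estimate n \<epsilon> E =
    (\<Sum>T\<in>triples n. \<Prod>e\<in>edges_of T. edge_estimate \<epsilon> (e \<in> G) (e \<in> E))"
proof -
  let ?c = "\<lambda>T. card (E \<inter> edges_of T)"
  have span: "real (triples_spanning n E k) = (\<Sum>T\<in>triples n. of_bool (?c T = k))" for k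
  proof -
    \<comment> \<open>All members of \<open>E\<close> have two elements, so those inside
      \<open>T\<close> are edges of \<open>T\<close>.\<close>
    have "{e \<in> E. e \<subseteq> T} = E \<inter> edges_of T" for T
      using assms by (auto simp: edges_of_def possible_edges_def)
    then have "triples_spanning n E k = card {T \<in> triples n. ?c T = k}"
      by (simp add: triples_spanning_def triples_def)
    then show ?thesis by (simp add: Int_def)
  qed
  have each: "exp (3 * \<epsilon>) * of_bool (?c T = 3) - exp (2 * \<epsilon>) * of_bool (?c T = 2) +
      exp \<epsilon> * of_bool (?c T = 1) - of_bool (?c T = 0) =
    exp \<epsilon> ^ ?c T * (-1) ^ (3 - ?c T)" if "T \<in> triples n" for T
  proof -
    have "?c T \<le> 3"
      using card_mono[OF finite_edges_of[OF that], of "E \<inter> edges_of T"] card_edges_of[OF that]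
      by simp
    then consider "?c T = 0" | "?c T = 1" | "?c T = 2" | "?c T = 3" by linarith
    then show ?thesis
      by cases (simp_all add: exp_of_nat_mult[symmetric])
  qed
  have "triangle_estimate n \<epsilon> E = 1 / (exp \<epsilon> - 1) ^ 3 * (\<Sum>T\<in>triples n.
      exp (3 * \<epsilon>) * of_bool (?c T = 3) - exp (2 * \<epsilon>) * of_bool (?c T = 2) +
      exp \<epsilon> * of_bool (?c T = 1) - of_bool (?c T = 0))"
    unfolding triangle_estimate_def span
    by (simp only: sum_distrib_left sum.distrib sum_subtractf)
  also have "\<dots> = (\<Sum>T\<in>triples n. \<Prod>e\<in>edges_of T. edge_estimate \<epsilon> (e \<in> G) (e \<in> E))"
    unfolding sum_distrib_left
    by (intro sum.cong refl, subst each, assumption, subst prod_edge_estimate, assumption) simp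
  finally show ?thesis .
qed

lemma error_eq_sum:
  assumes "E \<subseteq> possible_edges n"
  shows "triangle_estimate n \<epsilon> E - real (triangles n G) = (\<Sum>T\<in>triples n. triple_error \<epsilon> T G E)"
  using triangle_estimate_eq_sum[OF assms] triangles_eq_sum
  by (simp add: triple_error_def sum_subtractf)

section \<open>Second moments and correlations of triple errors\<close>

lemma integrable_edge_outcome [simp]:
  "integrable (measure_pmf (edge_outcome n \<alpha> \<epsilon>)) (f :: _ \<Rightarrow> real)"
  by (simp add: integrable_measure_pmf_finite)

text \<open>Multiplying out the two differences gives four products. Weight and true bit have the
  same mean \<alpha>, so by independence each product has mean
  \<open>\<alpha> ^ 3 * \<alpha> ^ 3\<close>, and the signs cancel.\<close>

lemma expectation_disjoint_errors:
  assumes "0 \<le> \<alpha>" "\<alpha> \<le> 1" "0 < \<epsilon>" "S \<in> triples n" "T \<in> triples n"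
    and "edges_of S \<inter> edges_of T = {}"
  shows "measure_pmf.expectation (edge_outcome n \<alpha> \<epsilon>)
    (\<lambda>(G, E). triple_error \<epsilon> S G E * triple_error \<epsilon> T G E) = 0"
proof -
  let ?P = "\<lambda>S f z. \<Prod>e\<in>edges_of S. f (e \<in> fst z) (e \<in> snd z) :: real"
  let ?W = "edge_estimate \<epsilon>"
  let ?X = "edge_truth"
  have *: "measure_pmf.expectation (edge_outcome n \<alpha> \<epsilon>) (\<lambda>z. ?P S f z * ?P T g z) = \<alpha> ^ 3 * \<alpha> ^ 3"
    if "f \<in> {?W, ?X}" "g \<in> {?W, ?X}" for f g
  proof -
    have "bit_mean \<alpha> \<epsilon> f = \<alpha>" "bit_mean \<alpha> \<epsilon> g = \<alpha>"
      using that assms(1-3) bit_mean_edge_estimate bit_mean_edge_truth by auto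
    then show ?thesis
      using expectation_disjoint_edge_products[OF assms(4,5)[THEN edges_of_subset] assms(6), of \<alpha> \<epsilon> f g]
        assms(4,5)[THEN card_edges_of] by (simp add: case_prod_unfold)
  qed
  have "(\<lambda>(G, E). triple_error \<epsilon> S G E * triple_error \<epsilon> T G E) =
    (\<lambda>z. (?P S ?W z * ?P T ?W z - ?P S ?W z * ?P T ?X z) -
      (?P S ?X z * ?P T ?W z - ?P S ?X z * ?P T ?X z))"
    by (auto simp: triple_error_def algebra_simps)
  then show ?thesis
    by (simp add: *)
qed

text \<open>The inequality \<open>(x - y)\<^sup>2 \<le> 2 * x\<^sup>2 + 2 * y\<^sup>2\<close>
  separates estimate from truth, and each square then factors over the three edges.\<close>

lemma expectation_error_square_le:
  assumes "0 \<le> \<alpha>" "\<alpha> \<le> 1" "0 < \<epsilon>" "T \<in> triples n"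
  defines "p \<equiv> 1 / (exp \<epsilon> + 1)"
  defines "\<beta> \<equiv> \<alpha> * (1 - p) + (1 - \<alpha>) * p"
  shows "measure_pmf.expectation (edge_outcome n \<alpha> \<epsilon>) (\<lambda>(G, E). (triple_error \<epsilon> T G E)\<^sup>2)
    \<le> 10 * (exp (6 * \<epsilon>) / (exp \<epsilon> - 1) ^ 6 * \<beta>)"
proof -
  let ?M = "measure_pmf (edge_outcome n \<alpha> \<epsilon>)"
  let ?P = "\<lambda>f (G, E). (\<Prod>e\<in>edges_of T. f (e \<in> G) (e \<in> E))\<^sup>2 :: real"
  \<comment> \<open>The cube of \<open>r\<close> is the target factor in \<epsilon>, and
    \<open>1 \<le> r\<close> allows it to be inserted into the bound for the truth.\<close>
  define r where "r = exp \<epsilon> ^ 2 / (exp \<epsilon> - 1) ^ 2"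
  define m where "m = bit_mean \<alpha> \<epsilon> (\<lambda>x y. (edge_estimate \<epsilon> x y)\<^sup>2)"
  note b = edge_mean_square_bounds[OF assms(1-3), folded p_def, folded \<beta>_def m_def]
  have m: "m \<le> 3 * (r * \<beta>)" "m \<le> r" "0 \<le> m" using b by (simp_all add: r_def)
  have "exp \<epsilon> > 1" using assms by simp
  then have "1 \<le> r" unfolding r_def by (simp add: power_mono)
  have r3: "r ^ 3 = exp (6 * \<epsilon>) / (exp \<epsilon> - 1) ^ 6"
    by (simp add: r_def power_divide flip: power_mult exp_of_nat_mult)
  have "m ^ 3 = m\<^sup>2 * m" by (simp add: eval_nat_numeral)
  also have "\<dots> \<le> r\<^sup>2 * (3 * (r * \<beta>))"
    using m \<open>1 \<le> r\<close> by (intro mult_mono power_mono) auto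
  also have "\<dots> = 3 * (r ^ 3 * \<beta>)" by (simp add: eval_nat_numeral)
  finally have m3: "m ^ 3 \<le> 3 * (r ^ 3 * \<beta>)" .
  have "\<alpha> ^ 3 \<le> \<alpha> ^ 1" using assms by (intro power_decreasing) auto
  also have "\<dots> \<le> 2 * \<beta>" using b by simp
  also have "\<dots> \<le> 2 * (r ^ 3 * \<beta>)"
    using mult_right_mono[OF one_le_power[OF \<open>1 \<le> r\<close>], of \<beta> 3] b by simp
  finally have \<alpha>3: "\<alpha> ^ 3 \<le> 2 * (r ^ 3 * \<beta>)" .
  \<comment> \<open>Bits are idempotent, so the second moment of the true bit is its mean
    \<alpha>.\<close>
  have sq: "edge_truth x y ^ 2 = edge_truth x y" for x y by (simp add: edge_truth_def)
  have "(x - y)\<^sup>2 \<le> 2 * x\<^sup>2 + 2 * y\<^sup>2" for x y :: real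
    using zero_le_power2[of "x + y"] by (simp add: power2_eq_square algebra_simps)
  then have "measure_pmf.expectation (edge_outcome n \<alpha> \<epsilon>) (\<lambda>(G, E). (triple_error \<epsilon> T G E)\<^sup>2)
    \<le> measure_pmf.expectation (edge_outcome n \<alpha> \<epsilon>)
       (\<lambda>z. 2 * ?P (edge_estimate \<epsilon>) z + 2 * ?P edge_truth z)"
    by (intro integral_mono) (auto simp: triple_error_def)
  also have "\<dots> = 2 * m ^ 3 + 2 * \<alpha> ^ 3"
    using assms(1,2) card_edges_of[OF assms(4)]
    by (simp add: expectation_edge_product_square[OF edges_of_subset[OF assms(4)]] sq
        bit_mean_edge_truth m_def)
  \<comment> \<open>The constant is 10 = 2 * 3 + 2 * 2.\<close>
  also have "\<dots> \<le> 10 * (r ^ 3 * \<beta>)" using m3 \<alpha>3 by simp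
  finally show ?thesis by (simp add: r3)
qed

section \<open>Counting dependent pairs and assembling the bound\<close>

lemma card_sharing_pairs_le:
  "card {(S, T). S \<in> triples n \<and> T \<in> triples n \<and> edges_of S \<inter> edges_of T \<noteq> {}} \<le> n ^ 4"
    (is "card ?A \<le> _")
proof -
  let ?B = "{1..n} \<times> {1..n} \<times> {1..n} \<times> {1..n}"
  let ?f = "\<lambda>(i, j, a, b). ({i, j, a}, {i, j, b})"
  \<comment> \<open>Two triples with a common edge are described by four nodes: the endpoints
    \<open>i\<close>, \<open>j\<close> of that edge and the third node of each triple. Degenerate
    quadruples do no harm, since only a covering is needed.\<close>
  have complete: "\<exists>a\<in>{1..n}. T = {i, j, a}"
    if "T \<in> triples n" "{i, j} \<subseteq> T" "i \<noteq> j" for T i j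
    using that by (auto simp: triples_def card_3_iff)
  have "?A \<subseteq> ?f ` ?B"
  proof clarify
    fix S T assume ST: "S \<in> triples n" "T \<in> triples n" "edges_of S \<inter> edges_of T \<noteq> {}"
    then obtain i j where ij: "i \<noteq> j" "{i, j} \<subseteq> S" "{i, j} \<subseteq> T"
      by (auto simp: edges_of_def card_2_iff)
    then obtain a b where "a \<in> {1..n}" "S = {i, j, a}" "b \<in> {1..n}" "T = {i, j, b}"
      using complete[OF ST(1)] complete[OF ST(2)] by meson
    moreover have "i \<in> {1..n}" "j \<in> {1..n}" using ij ST by (auto simp: triples_def)
    ultimately show "(S, T) \<in> ?f ` ?B"
      by (intro image_eqI[where x = "(i, j, a, b)"]) auto
  qed
  then have "card ?A \<le> card ?B"
    by (intro surj_card_le) auto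
  then show ?thesis by (simp add: eval_nat_numeral)
qed

lemma expectation_error_bound:
  assumes "0 \<le> \<alpha>" "\<alpha> \<le> 1" "0 < \<epsilon>"
  defines "p \<equiv> 1 / (exp \<epsilon> + 1)"
  defines "\<beta> \<equiv> \<alpha> * (1 - p) + (1 - \<alpha>) * p"
  shows "measure_pmf.expectation (edge_outcome n \<alpha> \<epsilon>)
      (\<lambda>(G, E). (\<Sum>T\<in>triples n. triple_error \<epsilon> T G E)\<^sup>2)
    \<le> 10 * (exp (6 * \<epsilon>) / (exp \<epsilon> - 1) ^ 6 * \<beta> * real n ^ 4)"
proof -
  define K where "K = 10 * (exp (6 * \<epsilon>) / (exp \<epsilon> - 1) ^ 6 * \<beta>)"
  define D where "D = (\<lambda>T (G, E). triple_error \<epsilon> T G E)"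
  let ?E = "measure_pmf.expectation (edge_outcome n \<alpha> \<epsilon>)"
  let ?A = "{(S, T). S \<in> triples n \<and> T \<in> triples n \<and> edges_of S \<inter> edges_of T \<noteq> {}}"
  \<comment> \<open>Nonnegativity permits replacing the number of pairs by its upper bound
    \<open>n ^ 4\<close>.\<close>
  have "0 \<le> K"
    using edge_mean_square_bounds(5)[OF assms(1-3)] assms(3) by (simp add: K_def \<beta>_def p_def)
  have sq: "?E (\<lambda>z. (D T z)\<^sup>2) \<le> K" if "T \<in> triples n" for T
    using expectation_error_square_le[OF assms(1-3) that]
    by (simp add: D_def K_def \<beta>_def p_def case_prod_unfold)
  have pair: "?E (\<lambda>z. D S z * D T z) \<le> K" if "S \<in> triples n" "T \<in> triples n" for S T
  proof -
    have "x * y \<le> x\<^sup>2 / 2 + y\<^sup>2 / 2" for x y :: real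
      using zero_le_power2[of "x - y"] by (simp add: power2_eq_square algebra_simps)
    then have "?E (\<lambda>z. D S z * D T z) \<le> ?E (\<lambda>z. (D S z)\<^sup>2 / 2 + (D T z)\<^sup>2 / 2)"
      by (intro integral_mono) auto
    also have "\<dots> \<le> K" using sq[OF that(1)] sq[OF that(2)] by simp
    finally show ?thesis .
  qed
  have "(\<lambda>(G, E). (\<Sum>T\<in>triples n. triple_error \<epsilon> T G E)\<^sup>2) =
    (\<lambda>z. \<Sum>(S, T)\<in>triples n \<times> triples n. D S z * D T z)"
    by (auto simp: D_def power2_eq_square sum_product sum.cartesian_product)
  then have "?E (\<lambda>(G, E). (\<Sum>T\<in>triples n. triple_error \<epsilon> T G E)\<^sup>2) =
    (\<Sum>(S, T)\<in>triples n \<times> triples n. ?E (\<lambda>z. D S z * D T z))"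
    by (simp add: case_prod_unfold)
  \<comment> \<open>Pairs without a common edge drop out; the diagonal pairs remain, since a triple
    shares its edges with itself.\<close>
  also have "\<dots> = (\<Sum>(S, T)\<in>?A. ?E (\<lambda>z. D S z * D T z))"
    using expectation_disjoint_errors[OF assms(1-3)]
    by (intro sum.mono_neutral_right) (auto simp: D_def case_prod_unfold)
  also have "\<dots> \<le> of_nat (card ?A) * K"
    using pair by (intro sum_bounded_above) auto
  also have "\<dots> \<le> real n ^ 4 * K"
    using card_sharing_pairs_le[of n] \<open>0 \<le> K\<close>
    by (intro mult_right_mono) (simp_all flip: of_nat_power)
  finally show ?thesis by (simp add: K_def mult_ac)
qed

theorem theorem4:
  "\<exists>C::real. \<forall>(n::nat) (\<alpha>::real) (\<epsilon>::real). 0 \<le> \<alpha> \<longrightarrow> \<alpha> \<le> 1 \<longrightarrow> 0 < \<epsilon> \<longrightarrow>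
     (let p = 1 / (exp \<epsilon> + 1);
          \<beta> = \<alpha> * (1 - p) + (1 - \<alpha>) * p
      in measure_pmf.expectation
           (erdos_renyi n \<alpha> \<bind>
             (\<lambda>G. map_pmf (\<lambda>f. (G, f)) (local_rr_triangle n \<epsilon> G)))
           (\<lambda>(G, f). (f - real (triangles n G))\<^sup>2)
         \<le> C * (exp (6 * \<epsilon>) / (exp \<epsilon> - 1) ^ 6 * \<beta> * real n ^ 4))"
proof -
  have "measure_pmf.expectation
      (erdos_renyi n \<alpha> \<bind> (\<lambda>G. map_pmf (\<lambda>f. (G, f)) (local_rr_triangle n \<epsilon> G)))
      (\<lambda>(G, f). (f - real (triangles n G))\<^sup>2) =
    measure_pmf.expectation (edge_outcome n \<alpha> \<epsilon>)
      (\<lambda>(G, E). (\<Sum>T\<in>triples n. triple_error \<epsilon> T G E)\<^sup>2)" for n \<alpha> \<epsilon>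
  proof -
    \<comment> \<open>The estimate is a function of the noisy graph, so the pair of graph and output
      is an image of \<open>edge_outcome\<close>.\<close>
    have "erdos_renyi n \<alpha> \<bind> (\<lambda>G. map_pmf (\<lambda>f. (G, f)) (local_rr_triangle n \<epsilon> G)) =
      map_pmf (\<lambda>(G, E). (G, triangle_estimate n \<epsilon> E)) (edge_outcome n \<alpha> \<epsilon>)"
      by (simp add: edge_outcome_def local_rr_triangle_def map_bind_pmf pmf.map_comp o_def)
    then show ?thesis
      \<comment> \<open>The decomposition of the error requires the noisy graph to consist of
        possible edges, which holds on the support of \<open>edge_outcome\<close>.\<close>
      by (auto intro!: integral_cong_AE
          simp: AE_measure_pmf_iff error_eq_sum[OF set_edge_outcome(2)] case_prod_unfold)
  qed
  then show ?thesis
    unfolding Let_def using expectation_error_bound by (intro exI[of _ 10]) auto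
qed

end
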